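(* For each $\delta\geq 1$ there is a constant $c(\delta)>0$, depending only on $\delta$, such that for every $n\in\mathbb{N}$ there is a family $\mathcal{H}=\{ H_i : i\in I\}$ of closed symmetric strips in $\mathbb{R}^n$ (the family depending on $n$ but not on $\delta$), $$H_i = \{x \in \mathbb{R}^n : | \langle x, v_i\rangle | \leq 1\},\qquad v_i\in\mathbb{R}^n,$$ with $\operatorname{vol}\left(\bigcap_{i\in I}H_i\right)=1$ and with the following property: for any $\delta \geq 1$ such that $s=n^{\delta}$ is an integer and any collection of indices $i_1, \dots, i_s \in I$, we have $$\operatorname{vol}(H_{i_1}\cap \cdots \cap H_{i_s})^{1/n} \geq c(\delta) \frac{\sqrt{n}}{\log(1+n)}.$$ In particular, if $s=n^{\delta}$ and $i_1, \dots, i_s \in I$ and $\beta>0$ are such that $$H_{i_1}\cap \cdots \cap H_{i_s} \subset \beta \bigcap_{i\in I}H_i,$$ then $$\beta \geq c(\delta) \frac{\sqrt{n}}{\log(1+n)}.$$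
   Context: $\operatorname{vol}$ denotes $n$-dimensional volume (Lebesgue measure) in $\mathbb{R}^n$, $\langle\cdot,\cdot\rangle$ is the standard Euclidean inner product, and $\beta A=\{\beta a: a\in A\}$ for a set $A\subset\mathbb{R}^n$. *)

theory Defs
  imports "HOL-Analysis.Analysis"
begin

text \<open>
  The dimension has to be a bound variable, below the constant and above the family of strips, so it
  cannot be a type. Hence \<open>\<real>\<^sup>n\<close> is the set of functions with coordinates indexed by \<open>{..<n}\<close>
  (extensional, i.e. \<open>undefined\<close> elsewhere).
\<close>

abbreviation Rn :: "nat \<Rightarrow> (nat \<Rightarrow> real) set" where
  "Rn n \<equiv> {..<n} \<rightarrow>\<^sub>E UNIV"

definition inner_Rn :: "nat \<Rightarrow> (nat \<Rightarrow> real) \<Rightarrow> (nat \<Rightarrow> real) \<Rightarrow> real" where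
  "inner_Rn n x y = (\<Sum>k<n. x k * y k)"

definition scale_Rn :: "nat \<Rightarrow> real \<Rightarrow> (nat \<Rightarrow> real) set \<Rightarrow> (nat \<Rightarrow> real) set" where
  "scale_Rn n \<beta> A = (\<lambda>a. \<lambda>k\<in>{..<n}. \<beta> * a k) ` A"

text \<open>
  The volume is extended-valued, since an intersection of strips may be unbounded and of infinite
  volume. The product measure is Lebesgue measure on the Borel sets, which is enough because
  intersections of closed strips are closed.
\<close>

definition vol :: "nat \<Rightarrow> (nat \<Rightarrow> real) set \<Rightarrow> ennreal" where
  "vol n A = emeasure (Pi\<^sub>M {..<n} (\<lambda>_. lborel)) A"

definition ennreal_root :: "nat \<Rightarrow> ennreal \<Rightarrow> ennreal" where
  "ennreal_root n x = (if x = \<infinity> then \<infinity> else ennreal (root n (enn2real x)))"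

definition strip :: "nat \<Rightarrow> (nat \<Rightarrow> real) \<Rightarrow> (nat \<Rightarrow> real) set" where
  "strip n v = {x \<in> Rn n. \<bar>inner_Rn n x v\<bar> \<le> 1}"

end

theory Submission
  imports Defs "HOL-Probability.Distributions"
begin

text \<open>
  The strips are all those containing the Euclidean ball \<open>K\<close> of volume 1. Comparing with the Gaussian
  integral shows that its radius \<open>r\<close> is at least of order \<open>\<surd>n\<close>. The exponential-moment bound for a
  linear functional and a union bound show that \<open>s\<close> strips of half-width \<open>t\<close> about the origin, with
  \<open>t\<^sup>2 = 2 ln (4 s)\<close>, together carry at least half of the Gaussian measure, so their intersection has
  volume at least 1. Rescaling by \<open>r / t\<close> bounds the volume radius of the intersection of any
  \<open>s = n\<^sup>\<delta>\<close> strips of the family from below by \<open>r / t\<close>, where \<open>t\<close> is of order \<open>\<surd>(\<delta> ln (1 + n))\<close>.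
\<close>

section \<open>Lebesgue measure on \<open>Rn n\<close> and measurability\<close>

abbreviation lborel_Rn :: "nat \<Rightarrow> (nat \<Rightarrow> real) measure" where
  "lborel_Rn n \<equiv> Pi\<^sub>M {..<n} (\<lambda>_. lborel)"

text \<open>The dilation underlying \<open>scale_Rn\<close>. The restriction to
  \<open>{..<n}\<close> makes every value extensional, so that it lies in \<open>Rn n\<close>
  whatever the argument.\<close>

definition scale_map :: "nat \<Rightarrow> real \<Rightarrow> (nat \<Rightarrow> real) \<Rightarrow> nat \<Rightarrow> real" where
  "scale_map n \<beta> a = (\<lambda>k\<in>{..<n}. \<beta> * a k)"

definition ball_Rn :: "nat \<Rightarrow> real \<Rightarrow> (nat \<Rightarrow> real) set" where
  "ball_Rn n r = {x \<in> Rn n. inner_Rn n x x \<le> r\<^sup>2}"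

interpretation lborel_product: product_sigma_finite "\<lambda>_::nat. lborel :: real measure"
  by standard

lemma space_lborel_Rn [simp]: "space (lborel_Rn n) = Rn n"
  by (simp add: space_PiM)

lemma measurable_inner_Rn [measurable]: "(\<lambda>x. inner_Rn n x v) \<in> borel_measurable (lborel_Rn n)"
  unfolding inner_Rn_def by measurable

lemma measurable_inner_Rn_self [measurable]: "(\<lambda>x. inner_Rn n x x) \<in> borel_measurable (lborel_Rn n)"
  unfolding inner_Rn_def by measurable

lemma measurable_scale_map [measurable]: "scale_map n \<beta> \<in> measurable (lborel_Rn n) (lborel_Rn n)"
  unfolding scale_map_def by measurable

lemma sets_strip: "strip n v \<in> sets (lborel_Rn n)"
proof -
  have "{x \<in> space (lborel_Rn n). \<bar>inner_Rn n x v\<bar> \<le> 1} \<in> sets (lborel_Rn n)"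
    by measurable
  then show ?thesis by (simp add: strip_def)
qed

lemma sets_ball_Rn: "ball_Rn n r \<in> sets (lborel_Rn n)"
proof -
  have "{x \<in> space (lborel_Rn n). inner_Rn n x x \<le> r\<^sup>2} \<in> sets (lborel_Rn n)"
    by measurable
  then show ?thesis by (simp add: ball_Rn_def)
qed

lemma inner_Rn_self_nonneg: "inner_Rn n x x \<ge> 0"
  by (simp add: inner_Rn_def sum_nonneg)

lemma scale_map_mem_Rn: "scale_map n \<beta> x \<in> Rn n"
  by (auto simp: scale_map_def)

section \<open>Dilations and volume\<close>

text \<open>Measurability and pushforward measures speak of preimages, so the image under a dilation
  is traded for the preimage under the inverse dilation.\<close>

lemma scale_Rn_eq_vimage:
  assumes "\<beta> \<noteq> 0" "A \<subseteq> Rn n"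
  shows "scale_Rn n \<beta> A = scale_map n (1 / \<beta>) -` A \<inter> Rn n"
proof -
  have inv: "scale_map n (1 / c) (scale_map n c x) = x" if "c \<noteq> 0" "x \<in> Rn n" for c x
    using that by (auto simp: scale_map_def fun_eq_iff PiE_def extensional_def)
  have "scale_map n \<beta> x \<in> Rn n" for x
    by (rule scale_map_mem_Rn)
  moreover have "scale_Rn n \<beta> A = scale_map n \<beta> ` A"
    by (simp add: scale_Rn_def scale_map_def)
  moreover have "x \<in> scale_map n \<beta> ` A" if "scale_map n (1 / \<beta>) x \<in> A" "x \<in> Rn n" for x
    using inv[of "1 / \<beta>" x] assms that by (intro image_eqI[of _ _ "scale_map n (1 / \<beta>) x"]) auto
  ultimately show ?thesis
    using inv[of \<beta>] assms by auto
qed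

lemma emeasure_lborel_vimage_mult:
  assumes "\<beta> > 0" "B \<in> sets borel"
  shows "emeasure lborel ((\<lambda>x. \<beta> * x) -` B) = ennreal (1 / \<beta>) * emeasure lborel B"
proof -
  have "lborel = density (distr lborel borel (\<lambda>x. 0 + \<beta> * x)) (\<lambda>_. ennreal \<bar>\<beta>\<bar>)"
    using assms by (intro lborel_real_affine) auto
  then have "emeasure lborel B
      = emeasure (density (distr lborel borel (\<lambda>x. 0 + \<beta> * x)) (\<lambda>_. ennreal \<bar>\<beta>\<bar>)) B"
    by simp
  also have "\<dots> = ennreal \<beta> * emeasure lborel ((\<lambda>x. \<beta> * x) -` B)"
    using assms by (simp add: emeasure_density_const emeasure_distr)
  finally have "ennreal (1 / \<beta>) * emeasure lborel B
      = ennreal (1 / \<beta>) * (ennreal \<beta> * emeasure lborel ((\<lambda>x. \<beta> * x) -` B))"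
    by simp
  also have "\<dots> = emeasure lborel ((\<lambda>x. \<beta> * x) -` B)"
    using assms by (simp flip: mult.assoc ennreal_mult)
  finally show ?thesis by simp
qed

text \<open>The product measure is determined by its values on boxes, and a dilation pulls a box
  back to a box. Each of the \<open>n\<close> sides contributes a factor \<open>1 / \<beta>\<close>,
  which the density cancels.\<close>

lemma distr_scale_map:
  assumes "\<beta> > 0"
  shows "lborel_Rn n = density (distr (lborel_Rn n) (lborel_Rn n) (scale_map n \<beta>)) (\<lambda>_. ennreal \<beta> ^ n)"
proof (rule lborel_product.PiM_eqI[symmetric])
  fix B :: "nat \<Rightarrow> real set"
  assume B: "\<And>k. k \<in> {..<n} \<Longrightarrow> B k \<in> sets lborel"
  have box: "(\<Pi>\<^sub>E k\<in>{..<n}. B k) \<in> sets (lborel_Rn n)"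
    using B by (intro sets_PiM_I_finite) auto
  have "scale_map n \<beta> -` (\<Pi>\<^sub>E k\<in>{..<n}. B k) \<inter> Rn n = (\<Pi>\<^sub>E k\<in>{..<n}. (\<lambda>x. \<beta> * x) -` B k)"
    by (auto simp: scale_map_def PiE_def Pi_def)
  then have "emeasure (density (distr (lborel_Rn n) (lborel_Rn n) (scale_map n \<beta>)) (\<lambda>_. ennreal \<beta> ^ n))
        (\<Pi>\<^sub>E k\<in>{..<n}. B k)
      = ennreal \<beta> ^ n * emeasure (lborel_Rn n) (\<Pi>\<^sub>E k\<in>{..<n}. (\<lambda>x. \<beta> * x) -` B k)"
    using box by (simp add: emeasure_density_const emeasure_distr)
  also have "emeasure (lborel_Rn n) (\<Pi>\<^sub>E k\<in>{..<n}. (\<lambda>x. \<beta> * x) -` B k)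
      = (\<Prod>k<n. emeasure lborel ((\<lambda>x. \<beta> * x) -` B k))"
  proof (rule lborel_product.emeasure_PiM)
    show "(\<lambda>x. \<beta> * x) -` B k \<in> sets lborel" if "k \<in> {..<n}" for k
      using B[OF that] measurable_sets_borel[of "\<lambda>x. \<beta> * x" borel "B k"] by simp
  qed simp
  also have "\<dots> = (\<Prod>k<n. ennreal (1 / \<beta>) * emeasure lborel (B k))"
    using B assms by (intro prod.cong refl emeasure_lborel_vimage_mult) auto
  also have "ennreal \<beta> ^ n * \<dots> = (ennreal \<beta> * ennreal (1 / \<beta>)) ^ n * (\<Prod>k<n. emeasure lborel (B k))"
    by (simp add: prod.distrib power_mult_distrib mult.assoc)
  also have "ennreal \<beta> * ennreal (1 / \<beta>) = 1"
    using assms by (simp flip: ennreal_mult)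
  finally show "emeasure (density (distr (lborel_Rn n) (lborel_Rn n) (scale_map n \<beta>)) (\<lambda>_. ennreal \<beta> ^ n))
        (\<Pi>\<^sub>E k\<in>{..<n}. B k) = (\<Prod>k<n. emeasure lborel (B k))"
    by simp
qed auto

lemma vol_scale_Rn:
  assumes "\<beta> > 0" and A: "A \<in> sets (lborel_Rn n)"
  shows "vol n (scale_Rn n \<beta> A) = ennreal \<beta> ^ n * vol n A"
proof -
  have "A \<subseteq> Rn n"
    using sets.sets_into_space[OF A] by simp
  then have eq: "scale_Rn n \<beta> A = scale_map n (1 / \<beta>) -` A \<inter> Rn n"
    using assms scale_Rn_eq_vimage by simp
  \<comment> \<open>The inverse factor \<open>1 / \<beta>\<close> enters because the dilated set is
    a preimage under the inverse dilation.\<close>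
  have "vol n A = emeasure (density (distr (lborel_Rn n) (lborel_Rn n) (scale_map n (1 / \<beta>)))
      (\<lambda>_. ennreal (1 / \<beta>) ^ n)) A"
    using distr_scale_map[of "1 / \<beta>" n] assms unfolding vol_def by simp
  also have "\<dots> = ennreal (1 / \<beta>) ^ n * vol n (scale_Rn n \<beta> A)"
    using A by (simp add: emeasure_density_const emeasure_distr eq vol_def)
  finally have "ennreal \<beta> ^ n * vol n A = (ennreal \<beta> * ennreal (1 / \<beta>)) ^ n * vol n (scale_Rn n \<beta> A)"
    by (simp add: power_mult_distrib mult.assoc)
  also have "ennreal \<beta> * ennreal (1 / \<beta>) = 1"
    using assms by (simp flip: ennreal_mult)
  finally show ?thesis by simp
qed

lemma sets_scale_Rn:
  assumes "\<beta> \<noteq> 0" and A: "A \<in> sets (lborel_Rn n)"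
  shows "scale_Rn n \<beta> A \<in> sets (lborel_Rn n)"
proof -
  have "A \<subseteq> Rn n"
    using sets.sets_into_space[OF A] by simp
  moreover have "scale_map n (1 / \<beta>) -` A \<inter> space (lborel_Rn n) \<in> sets (lborel_Rn n)"
    using A by measurable
  ultimately show ?thesis
    using assms scale_Rn_eq_vimage by simp
qed

section \<open>Gaussian integrals\<close>

text \<open>Completing the square turns the integrand into a multiple of the normal density with
  mean \<open>a\<close> and variance 1.\<close>

lemma nn_integral_exp_quadratic:
  "(\<integral>\<^sup>+x. ennreal (exp (a * x - x\<^sup>2 / 2)) \<partial>lborel) = ennreal (sqrt (2 * pi) * exp (a\<^sup>2 / 2))"
proof -
  have "(\<integral>\<^sup>+x. ennreal (exp (a * x - x\<^sup>2 / 2)) \<partial>lborel)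
      = (\<integral>\<^sup>+x. ennreal (sqrt (2 * pi) * exp (a\<^sup>2 / 2)) * ennreal (normal_density a 1 x) \<partial>lborel)"
  proof (rule nn_integral_cong)
    fix x :: real
    have "exp (a * x - x\<^sup>2 / 2) = exp (a\<^sup>2 / 2) * exp (- (x - a)\<^sup>2 / 2)"
      by (simp add: power2_eq_square field_simps flip: exp_add)
    then show "ennreal (exp (a * x - x\<^sup>2 / 2))
        = ennreal (sqrt (2 * pi) * exp (a\<^sup>2 / 2)) * ennreal (normal_density a 1 x)"
      by (simp add: normal_density_def flip: ennreal_mult)
  qed
  also have "\<dots> = ennreal (sqrt (2 * pi) * exp (a\<^sup>2 / 2)) * (\<integral>\<^sup>+x. ennreal (normal_density a 1 x) \<partial>lborel)"
    by (intro nn_integral_cmult) simp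
  also have "(\<integral>\<^sup>+x. ennreal (normal_density a 1 x) \<partial>lborel) = 1"
    by (subst nn_integral_eq_integral) auto
  finally show ?thesis by simp
qed

text \<open>The moment generating function of a linear functional under the unnormalised Gaussian
  weight, obtained coordinate by coordinate. The case \<open>\<mu> = 0\<close> gives the total mass
  \<open>sqrt (2 * pi) ^ n\<close>.\<close>

lemma nn_integral_gaussian_Rn:
  "(\<integral>\<^sup>+x. ennreal (exp (\<mu> * inner_Rn n x w - inner_Rn n x x / 2)) \<partial>lborel_Rn n)
    = ennreal (sqrt (2 * pi) ^ n * exp (\<mu>\<^sup>2 * inner_Rn n w w / 2))"
proof -
  have "ennreal (exp (\<mu> * inner_Rn n x w - inner_Rn n x x / 2))
      = (\<Prod>k<n. ennreal (exp ((\<mu> * w k) * x k - (x k)\<^sup>2 / 2)))" for x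
    by (simp add: inner_Rn_def prod_ennreal sum_distrib_left sum_divide_distrib power2_eq_square
        mult_ac flip: exp_sum sum_subtractf)
  then have "(\<integral>\<^sup>+x. ennreal (exp (\<mu> * inner_Rn n x w - inner_Rn n x x / 2)) \<partial>lborel_Rn n)
      = (\<Prod>k<n. \<integral>\<^sup>+x. ennreal (exp ((\<mu> * w k) * x - x\<^sup>2 / 2)) \<partial>lborel)"
    by (simp only:) (subst lborel_product.product_nn_integral_prod, auto)
  also have "\<dots> = ennreal (\<Prod>k<n. sqrt (2 * pi) * exp ((\<mu> * w k)\<^sup>2 / 2))"
    by (simp add: nn_integral_exp_quadratic prod_ennreal)
  also have "(\<Prod>k<n. sqrt (2 * pi) * exp ((\<mu> * w k)\<^sup>2 / 2))
      = sqrt (2 * pi) ^ n * exp (\<mu>\<^sup>2 * inner_Rn n w w / 2)"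
    by (simp add: prod.distrib inner_Rn_def power2_eq_square sum_distrib_left sum_divide_distrib
        mult_ac flip: exp_sum)
  finally show ?thesis .
qed

section \<open>The Euclidean ball of volume 1\<close>

text \<open>On this ball the Gaussian weight is at least \<open>exp (- n / 2)\<close>, so its volume
  is at most \<open>exp (n / 2)\<close> times the total Gaussian mass.\<close>

lemma vol_ball_Rn_le: "vol n (ball_Rn n (sqrt n)) \<le> ennreal ((sqrt (2 * pi) * exp (1 / 2)) ^ n)"
proof -
  have "vol n (ball_Rn n (sqrt n)) = (\<integral>\<^sup>+x. indicator (ball_Rn n (sqrt n)) x \<partial>lborel_Rn n)"
    by (simp add: vol_def sets_ball_Rn)
  also have "\<dots> \<le> (\<integral>\<^sup>+x. ennreal (exp (n / 2))
      * ennreal (exp (0 * inner_Rn n x (\<lambda>_. 0) - inner_Rn n x x / 2)) \<partial>lborel_Rn n)"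
    by (intro nn_integral_mono)
      (auto simp: indicator_def ball_Rn_def simp flip: ennreal_mult exp_add ennreal_1)
  also have "\<dots> = ennreal (exp (n / 2)) * ennreal (sqrt (2 * pi) ^ n)"
    by (subst nn_integral_cmult, measurable, subst nn_integral_gaussian_Rn) simp
  also have "\<dots> = ennreal ((sqrt (2 * pi) * exp (1 / 2)) ^ n)"
    by (simp add: power_mult_distrib mult.commute flip: ennreal_mult exp_of_nat_mult)
  finally show ?thesis .
qed

text \<open>A cube of half-side \<open>1 / n\<close> fits inside the unit ball: its points have
  coordinates with squares at most \<open>1 / n\<close>, and there are \<open>n\<close> of
  them.\<close>

lemma vol_ball_Rn_pos:
  assumes "n \<ge> 1"
  shows "vol n (ball_Rn n 1) > 0"
proof -
  have "(\<Pi>\<^sub>E k\<in>{..<n}. {- 1 / real n..1 / real n}) \<subseteq> ball_Rn n 1"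
  proof
    fix x assume x: "x \<in> (\<Pi>\<^sub>E k\<in>{..<n}. {- 1 / real n..1 / real n})"
    have "x k * x k \<le> 1 / n" if "k < n" for k
    proof -
      have "\<bar>x k\<bar> \<le> 1 / n"
        using PiE_mem[OF x, of k] that by auto
      moreover have "1 / n \<le> (1::real)"
        using assms by simp
      ultimately have "\<bar>x k\<bar> * \<bar>x k\<bar> \<le> (1 / n) * 1"
        by (intro mult_mono) auto
      then show ?thesis by simp
    qed
    then have "inner_Rn n x x \<le> (\<Sum>k<n. 1 / n)"
      unfolding inner_Rn_def by (intro sum_mono) auto
    then show "x \<in> ball_Rn n 1"
      using x assms by (auto simp: ball_Rn_def)
  qed
  then have "emeasure (lborel_Rn n) (\<Pi>\<^sub>E k\<in>{..<n}. {- 1 / real n..1 / real n}) \<le> vol n (ball_Rn n 1)"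
    unfolding vol_def by (intro emeasure_mono sets_ball_Rn)
  moreover have "emeasure (lborel_Rn n) (\<Pi>\<^sub>E k\<in>{..<n}. {- 1 / real n..1 / real n})
      = ennreal (2 / n) ^ n"
    by (subst lborel_product.emeasure_PiM) auto
  moreover have "ennreal (2 / n) ^ n > 0"
    using assms by (simp add: ennreal_power)
  ultimately show ?thesis by order
qed

lemma scale_ball_Rn:
  assumes "\<beta> > 0"
  shows "scale_Rn n \<beta> (ball_Rn n r) = ball_Rn n (\<beta> * r)"
proof -
  have "inner_Rn n (scale_map n (1 / \<beta>) x) (scale_map n (1 / \<beta>) x) = inner_Rn n x x / \<beta>\<^sup>2" for x
    by (simp add: inner_Rn_def scale_map_def power2_eq_square sum_divide_distrib)
  then show ?thesis
    using assms by (subst scale_Rn_eq_vimage)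
      (auto simp: ball_Rn_def scale_map_mem_Rn divide_le_eq power_mult_distrib mult.commute)
qed

text \<open>With \<open>V\<close> the volume of the unit ball, homogeneity turns the bound on the
  ball of radius \<open>sqrt n\<close> into \<open>sqrt n ^ n * V \<le> ?C ^ n\<close>. Multiplying
  by \<open>r ^ n\<close>, where \<open>r ^ n * V = 1\<close>, and taking roots gives
  \<open>sqrt n \<le> ?C * r\<close>.\<close>

lemma unit_volume_ball:
  assumes "n \<ge> 1"
  obtains r where "r \<ge> sqrt n / 5" "vol n (ball_Rn n r) = 1"
proof -
  let ?C = "sqrt (2 * pi) * exp (1 / 2)"
  have vol1: "vol n (ball_Rn n \<beta>) = ennreal \<beta> ^ n * vol n (ball_Rn n 1)" if "\<beta> > 0" for \<beta>
    using vol_scale_Rn[OF that sets_ball_Rn, of n 1] scale_ball_Rn[OF that, of n 1] by simp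
  have upper: "ennreal (sqrt n) ^ n * vol n (ball_Rn n 1) \<le> ennreal (?C ^ n)"
    using vol_ball_Rn_le[of n] vol1[of "sqrt n"] assms by simp
  have "vol n (ball_Rn n 1) \<noteq> \<infinity>"
    using upper assms by (auto simp: ennreal_mult_top ennreal_power top_unique)
  then obtain V where V: "V > 0" "vol n (ball_Rn n 1) = ennreal V"
    using vol_ball_Rn_pos[OF assms] by (cases "vol n (ball_Rn n 1)") auto
  define r where "r = 1 / root n V"
  have r: "r > 0" "r ^ n * V = 1"
    using V assms by (auto simp: r_def power_divide)
  have "sqrt n ^ n * V \<le> ?C ^ n"
    using upper V by (simp add: ennreal_power flip: ennreal_mult)
  then have "r ^ n * (sqrt n ^ n * V) \<le> r ^ n * ?C ^ n"
    using r by (intro mult_left_mono) auto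
  then have "sqrt n ^ n * (r ^ n * V) \<le> (?C * r) ^ n"
    by (simp add: power_mult_distrib mult_ac)
  then have "sqrt n ^ n \<le> (?C * r) ^ n"
    using r by simp
  then have "sqrt n \<le> ?C * r"
    using r assms by (subst (asm) power_mono_iff) auto
  \<comment> \<open>The square of \<open>?C\<close> is \<open>2 * pi * exp 1\<close>, at most 24,
    hence the 5.\<close>
  also have "?C \<le> 5"
  proof (rule power2_le_imp_le)
    have "pi \<le> 4" "exp (1::real) \<le> 3"
      using pi_less_4 exp_le by auto
    moreover have "?C\<^sup>2 = 2 * pi * exp 1"
      by (simp add: power_mult_distrib flip: exp_double)
    moreover have "2 * pi * exp 1 \<le> 2 * 4 * (3::real)"
      using calculation by (intro mult_mono) auto
    ultimately show "?C\<^sup>2 \<le> 5\<^sup>2" by simp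
  qed simp
  finally have "r \<ge> sqrt n / 5"
    using r by simp
  moreover have "vol n (ball_Rn n r) = 1"
    using vol1[OF r(1)] r V by (simp add: ennreal_power flip: ennreal_mult)
  ultimately show thesis using that by blast
qed

section \<open>The ball as an intersection of strips\<close>

text \<open>Polarity of balls: the vectors of length at most \<open>1 / r\<close> form the polar of
  the ball of radius \<open>r\<close>. One inclusion is Cauchy-Schwarz; the other tests
  \<open>x\<close> against its own direction.\<close>

lemma ball_Rn_eq_INT_strip:
  assumes "r > 0"
  shows "ball_Rn n r = (\<Inter>v \<in> {v \<in> Rn n. r\<^sup>2 * inner_Rn n v v \<le> 1}. strip n v)"
proof (intro equalityI subsetI)
  fix x assume x: "x \<in> ball_Rn n r"
  have "\<bar>inner_Rn n x v\<bar> \<le> 1" if "r\<^sup>2 * inner_Rn n v v \<le> 1" for v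
  proof -
    have "(inner_Rn n x v)\<^sup>2 \<le> inner_Rn n x x * inner_Rn n v v"
      unfolding inner_Rn_def using Cauchy_Schwarz_ineq_sum[of x v "{..<n}"]
      by (simp add: power2_eq_square)
    also have "\<dots> \<le> r\<^sup>2 * inner_Rn n v v"
      using x inner_Rn_self_nonneg by (intro mult_right_mono) (auto simp: ball_Rn_def)
    finally show ?thesis
      using that by (simp flip: abs_square_le_1)
  qed
  then show "x \<in> (\<Inter>v \<in> {v \<in> Rn n. r\<^sup>2 * inner_Rn n v v \<le> 1}. strip n v)"
    using x by (auto simp: strip_def ball_Rn_def)
next
  fix x assume x: "x \<in> (\<Inter>v \<in> {v \<in> Rn n. r\<^sup>2 * inner_Rn n v v \<le> 1}. strip n v)"
  \<comment> \<open>The zero vector belongs to the family and its strip is all of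
    \<open>Rn n\<close>, which places \<open>x\<close> there.\<close>
  have "(\<lambda>k\<in>{..<n}. 0) \<in> {v \<in> Rn n. r\<^sup>2 * inner_Rn n v v \<le> 1}"
    by (simp add: inner_Rn_def)
  then have "x \<in> strip n (\<lambda>k\<in>{..<n}. 0)"
    using x by blast
  then have xR: "x \<in> Rn n"
    by (simp add: strip_def)
  define q where "q = sqrt (inner_Rn n x x)"
  have q2: "q\<^sup>2 = inner_Rn n x x" and "q \<ge> 0"
    by (simp_all add: q_def inner_Rn_self_nonneg)
  \<comment> \<open>The direction of \<open>x\<close> with length \<open>1 / r\<close>, whose strip
    forces the length \<open>q\<close> of \<open>x\<close> to be at most \<open>r\<close>. For
    \<open>x\<close> of length 0, division by zero makes \<open>v\<close> the zero vector and the
    identities below still hold.\<close>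
  define v where "v = scale_map n (1 / (r * q)) x"
  have "inner_Rn n v v = inner_Rn n x x / (r * q)\<^sup>2" "inner_Rn n x v = inner_Rn n x x / (r * q)"
    by (simp_all add: v_def scale_map_def inner_Rn_def power2_eq_square sum_divide_distrib)
  then have vv: "r\<^sup>2 * inner_Rn n v v \<le> 1" and xv: "inner_Rn n x v = q / r"
    using assms by (auto simp: power_mult_distrib simp flip: q2) (auto simp: power2_eq_square)
  have "v \<in> {v \<in> Rn n. r\<^sup>2 * inner_Rn n v v \<le> 1}"
    using vv scale_map_mem_Rn[of n "1 / (r * q)" x] by (simp only: v_def mem_Collect_eq)
  then have "x \<in> strip n v"
    using x by blast
  then have "\<bar>inner_Rn n x v\<bar> \<le> 1"
    by (simp add: strip_def)
  then have "q \<le> r"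
    using xv \<open>q \<ge> 0\<close> assms by simp
  then have "q\<^sup>2 \<le> r\<^sup>2"
    using \<open>q \<ge> 0\<close> by (intro power_mono)
  then show "x \<in> ball_Rn n r"
    using q2 xR by (simp add: ball_Rn_def)
qed

section \<open>Volume of an intersection of few strips\<close>

text \<open>Each \<open>w j\<close> has length at most \<open>1 / t\<close>, so the complement of
  its strip carries at most the fraction \<open>2 * exp (- t\<^sup>2 / 2)\<close> of the Gaussian
  mass. By the bound on \<open>card J\<close> these fractions sum to at most one half, and since the
  weight never exceeds 1, the volume of the intersection is at least the remaining mass.\<close>

lemma vol_INT_strip_ge_1:
  assumes J: "finite J" "J \<noteq> {}" and n: "n \<ge> 1"
    and w: "\<And>j. j \<in> J \<Longrightarrow> t\<^sup>2 * inner_Rn n (w j) (w j) \<le> 1"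
    and t: "4 * real (card J) \<le> exp (t\<^sup>2 / 2)"
  shows "vol n (\<Inter>j\<in>J. strip n (w j)) \<ge> 1"
proof -
  define A where "A = (\<Inter>j\<in>J. strip n (w j))"
  \<comment> \<open>The Gaussian weight tilted by the exponential of a linear functional;
    \<open>g 0\<close> is the plain weight.\<close>
  define g where "g \<mu> u x = ennreal (exp (\<mu> * inner_Rn n x u - inner_Rn n x x / 2))"
    for \<mu> u x
  have g_meas [measurable]: "g \<mu> u \<in> borel_measurable (lborel_Rn n)" for \<mu> u
    unfolding g_def by measurable
  let ?G = "sqrt (2 * pi) ^ n"
  let ?E = "ennreal (exp (- t\<^sup>2))"
  have A_sets: "A \<in> sets (lborel_Rn n)"
    unfolding A_def using J sets_strip by (intro sets.finite_INT) auto
  \<comment> \<open>outside \<open>strip n (w j)\<close>, \<open>\<bar>inner_Rn n x (w j)\<bar> > 1\<close> gives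
    \<open>1 \<le> exp (- t\<^sup>2) * exp (\<plusminus> t\<^sup>2 * inner_Rn n x (w j))\<close> for one choice of sign\<close>
  have pointwise: "g 0 (\<lambda>_. 0) x \<le> indicator A x
      + (\<Sum>j\<in>J. ?E * (g (t\<^sup>2) (w j) x + g (- t\<^sup>2) (w j) x))" if x: "x \<in> Rn n" for x
  proof (cases "x \<in> A")
    case True
    have "g 0 (\<lambda>_. 0) x \<le> indicator A x"
      using True inner_Rn_self_nonneg[of n x] by (simp add: g_def flip: ennreal_1)
    then show ?thesis by (rule order_trans) simp
  next
    case False
    then obtain j where j: "j \<in> J" "\<bar>inner_Rn n x (w j)\<bar> > 1"
      using x by (auto simp: A_def strip_def)
    have "g 0 (\<lambda>_. 0) x \<le> ?E * (g (t\<^sup>2) (w j) x + g (- t\<^sup>2) (w j) x)"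
    proof (cases "inner_Rn n x (w j) > 1")
      case True
      then have "t\<^sup>2 * 1 \<le> t\<^sup>2 * inner_Rn n x (w j)"
        by (intro mult_left_mono) auto
      then have "g 0 (\<lambda>_. 0) x \<le> ?E * g (t\<^sup>2) (w j) x"
        by (simp add: g_def flip: ennreal_mult exp_add)
      then show ?thesis by (rule order_trans) (intro mult_left_mono, auto)
    next
      case False
      with j have "t\<^sup>2 * 1 \<le> t\<^sup>2 * (- inner_Rn n x (w j))"
        by (intro mult_left_mono) auto
      then have "g 0 (\<lambda>_. 0) x \<le> ?E * g (- t\<^sup>2) (w j) x"
        by (simp add: g_def flip: ennreal_mult exp_add)
      then show ?thesis by (rule order_trans) (intro mult_left_mono, auto)
    qed
    also have "\<dots> \<le> (\<Sum>j\<in>J. ?E * (g (t\<^sup>2) (w j) x + g (- t\<^sup>2) (w j) x))"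
      using J j by (intro member_le_sum) auto
    finally show ?thesis by (rule order_trans) simp
  qed
  \<comment> \<open>For \<open>\<mu>\<close> equal to plus or minus \<open>t\<^sup>2\<close> the
    total exponent is \<open>- t\<^sup>2\<close> plus half of
    \<open>t\<^sup>2 * (t\<^sup>2 * inner_Rn n (w j) (w j))\<close>, hence at most
    \<open>- t\<^sup>2 / 2\<close>.\<close>
  have tail: "?E * (\<integral>\<^sup>+x. g \<mu> (w j) x \<partial>lborel_Rn n) \<le> ennreal (?G * exp (- t\<^sup>2 / 2))"
    if "j \<in> J" "\<mu>\<^sup>2 = t\<^sup>2 * t\<^sup>2" for j \<mu>
  proof -
    have "t\<^sup>2 * (t\<^sup>2 * inner_Rn n (w j) (w j)) \<le> t\<^sup>2 * 1"
      using w[OF that(1)] by (intro mult_left_mono) auto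
    then have "exp (- t\<^sup>2) * exp (\<mu>\<^sup>2 * inner_Rn n (w j) (w j) / 2) \<le> exp (- t\<^sup>2 / 2)"
      using that(2) by (simp flip: exp_add)
    then have "?G * (exp (- t\<^sup>2) * exp (\<mu>\<^sup>2 * inner_Rn n (w j) (w j) / 2)) \<le> ?G * exp (- t\<^sup>2 / 2)"
      by (intro mult_left_mono) auto
    then show ?thesis
      unfolding g_def nn_integral_gaussian_Rn by (simp add: mult_ac flip: ennreal_mult)
  qed
  have "ennreal ?G = (\<integral>\<^sup>+x. g 0 (\<lambda>_. 0) x \<partial>lborel_Rn n)"
    unfolding g_def nn_integral_gaussian_Rn by simp
  also have "\<dots> \<le> (\<integral>\<^sup>+x. indicator A x
      + (\<Sum>j\<in>J. ?E * (g (t\<^sup>2) (w j) x + g (- t\<^sup>2) (w j) x)) \<partial>lborel_Rn n)"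
    using pointwise by (intro nn_integral_mono) simp
  also have "\<dots> = vol n A + (\<Sum>j\<in>J. ?E * (\<integral>\<^sup>+x. g (t\<^sup>2) (w j) x \<partial>lborel_Rn n)
      + ?E * (\<integral>\<^sup>+x. g (- t\<^sup>2) (w j) x \<partial>lborel_Rn n))"
    using A_sets
    by (simp add: nn_integral_add nn_integral_sum nn_integral_cmult vol_def distrib_left)
  also have "\<dots> \<le> vol n A + (\<Sum>j\<in>J. ennreal (?G * exp (- t\<^sup>2 / 2)) + ennreal (?G * exp (- t\<^sup>2 / 2)))"
    by (intro add_left_mono sum_mono add_mono tail) (auto simp: power2_eq_square)
  also have "(\<Sum>j\<in>J. ennreal (?G * exp (- t\<^sup>2 / 2)) + ennreal (?G * exp (- t\<^sup>2 / 2)))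
      = ennreal (card J * (2 * (?G * exp (- t\<^sup>2 / 2))))"
    by (simp add: ennreal_of_nat_eq_real_of_nat flip: ennreal_mult ennreal_plus)
  also have "card J * (2 * (?G * exp (- t\<^sup>2 / 2))) = ?G / 2 * ((4 * card J) * exp (- t\<^sup>2 / 2))"
    by simp
  also have "\<dots> \<le> ?G / 2 * (exp (t\<^sup>2 / 2) * exp (- t\<^sup>2 / 2))"
    using t by (intro mult_left_mono mult_right_mono) auto
  also have "\<dots> = ?G / 2"
    by (simp flip: exp_add)
  finally have le: "ennreal ?G \<le> vol n A + ennreal (?G / 2)"
    by (simp add: add_left_mono ennreal_leI)
  \<comment> \<open>Half of the Gaussian mass is left for \<open>A\<close>; as
    \<open>n \<ge> 1\<close>, the whole mass \<open>?G\<close> is at least 2, so this half is at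
    least 1.\<close>
  have "2 \<le> sqrt (2 * pi)"
    using pi_ge_two by (intro real_le_rsqrt) auto
  also have "\<dots> = sqrt (2 * pi) ^ 1" by simp
  also have "\<dots> \<le> ?G"
    using n \<open>2 \<le> sqrt (2 * pi)\<close> by (intro power_increasing) linarith+
  finally have "?G \<ge> 2" .
  with le show ?thesis
    unfolding A_def[symmetric]
    by (cases "vol n A") (auto simp: top_unique simp flip: ennreal_plus ennreal_1)
qed

text \<open>Dividing the point by \<open>\<beta>\<close> and multiplying the vector by
  \<open>\<beta>\<close> preserves the inner product. An index is required because an empty
  intersection would be the whole function type instead of \<open>Rn n\<close>.\<close>

lemma scale_INT_strip:
  assumes "\<beta> > 0" "J \<noteq> {}"
  shows "scale_Rn n \<beta> (\<Inter>j\<in>J. strip n (scale_map n \<beta> (v j))) = (\<Inter>j\<in>J. strip n (v j))"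
proof -
  have "inner_Rn n (scale_map n (1 / \<beta>) x) (scale_map n \<beta> u) = inner_Rn n x u" for x u
    using assms by (simp add: inner_Rn_def scale_map_def)
  moreover have "(\<Inter>j\<in>J. strip n (scale_map n \<beta> (v j))) \<subseteq> Rn n"
    using assms by (auto simp: strip_def)
  ultimately show ?thesis
    using assms by (subst scale_Rn_eq_vimage) (auto simp: strip_def scale_map_mem_Rn)
qed

text \<open>Multiplying vectors of length at most \<open>1 / r\<close> by \<open>r / t\<close>
  brings them to length at most \<open>1 / t\<close>, where the intersection has volume at least 1.
  Dilating back by \<open>r / t\<close> multiplies the volume by \<open>(r / t) ^ n\<close>.\<close>

lemma vol_INT_strip_ge:
  assumes J: "finite J" "J \<noteq> {}" and n: "n \<ge> 1" and "r > 0" "t > 0"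
    and v: "\<And>j. j \<in> J \<Longrightarrow> r\<^sup>2 * inner_Rn n (v j) (v j) \<le> 1"
    and t: "4 * real (card J) \<le> exp (t\<^sup>2 / 2)"
  shows "vol n (\<Inter>j\<in>J. strip n (v j)) \<ge> ennreal ((r / t) ^ n)"
proof -
  let ?w = "\<lambda>j. scale_map n (r / t) (v j)"
  have rt: "r / t > 0"
    using assms by simp
  have "t\<^sup>2 * inner_Rn n (?w j) (?w j) = r\<^sup>2 * inner_Rn n (v j) (v j)" for j
    using \<open>t > 0\<close>
    by (simp add: inner_Rn_def scale_map_def power2_eq_square sum_distrib_left mult_ac)
  then have "vol n (\<Inter>j\<in>J. strip n (?w j)) \<ge> 1"
    using v by (intro vol_INT_strip_ge_1[OF J n _ t]) simp
  then have "ennreal (r / t) ^ n * 1 \<le> ennreal (r / t) ^ n * vol n (\<Inter>j\<in>J. strip n (?w j))"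
    by (rule mult_left_mono) simp
  also have "\<dots> = vol n (scale_Rn n (r / t) (\<Inter>j\<in>J. strip n (?w j)))"
    using J sets_strip by (intro vol_scale_Rn[OF rt, symmetric] sets.finite_INT) auto
  also have "scale_Rn n (r / t) (\<Inter>j\<in>J. strip n (?w j)) = (\<Inter>j\<in>J. strip n (v j))"
    by (rule scale_INT_strip[OF rt J(2)])
  finally have "vol n (\<Inter>j\<in>J. strip n (v j)) \<ge> ennreal (r / t) ^ n * 1" .
  then show ?thesis
    using rt by (simp add: ennreal_power)
qed

section \<open>From volumes to the final bound\<close>

lemma ennreal_root_ge:
  assumes "n \<ge> 1" "a \<ge> 0" "x \<ge> ennreal (a ^ n)"
  shows "ennreal_root n x \<ge> ennreal a"
proof (cases x)
  case (real y)
  then have "root n (a ^ n) \<le> root n y"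
    using assms by (intro real_root_le_mono) auto
  then show ?thesis
    using assms real by (simp add: ennreal_root_def real_root_power_cancel ennreal_leI)
qed (simp add: ennreal_root_def)

text \<open>The left side is the half-width \<open>t\<close> for \<open>s\<close> equal to
  \<open>n powr \<delta>\<close>. The quantity under the root is at least 1, so the root is crudely
  bounded by that quantity itself, linear in the logarithm.\<close>

lemma sqrt_ln_le:
  assumes "n \<ge> 1" "\<delta> \<ge> 1"
  shows "sqrt (2 * ln (4 * real n powr \<delta>)) \<le> (4 + 2 * \<delta>) * ln (1 + real n)"
proof -
  have ln4: "ln (4::real) = 2 * ln 2"
    using ln_realpow[of 2 2] by simp
  have eq: "2 * ln (4 * real n powr \<delta>) = 4 * ln 2 + 2 * \<delta> * ln n"
    using assms by (simp add: ln_mult ln_powr ln4)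
  have "ln 2 \<ge> (1/2 :: real)"
    using ln2_ge_two_thirds by simp
  moreover have "2 * \<delta> * ln n \<ge> 0"
    using assms by simp
  ultimately have one: "4 * ln 2 + 2 * \<delta> * ln n \<ge> 1"
    by linarith
  have "sqrt (4 * ln 2 + 2 * \<delta> * ln n) \<le> 4 * ln 2 + 2 * \<delta> * ln n"
    using one by (intro real_le_lsqrt) (auto simp: power2_eq_square mult_le_cancel_left1)
  \<comment> \<open>Both \<open>2\<close> and \<open>n\<close> are at most \<open>1 + n\<close>
    because \<open>n \<ge> 1\<close>.\<close>
  also have "\<dots> \<le> 4 * ln (1 + real n) + 2 * \<delta> * ln (1 + real n)"
    using assms by (intro add_mono mult_left_mono) auto
  finally show ?thesis
    by (simp add: eq distrib_right)
qed

theorem mainTheorem4: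
  shows "\<exists>c :: real \<Rightarrow> real. (\<forall>\<delta>\<ge>1. c \<delta> > 0) \<and>
    (\<forall>n::nat. n \<ge> 1 \<longrightarrow>
      (\<exists>(I :: (nat \<Rightarrow> real) set) (v :: (nat \<Rightarrow> real) \<Rightarrow> (nat \<Rightarrow> real)).
        (\<forall>i\<in>I. v i \<in> Rn n) \<and>
        vol n (\<Inter>i\<in>I. strip n (v i)) = 1 \<and>
        (\<forall>\<delta>::real. \<delta> \<ge> 1 \<longrightarrow>
          (\<forall>s::nat. real s = real n powr \<delta> \<longrightarrow>
            (\<forall>i :: nat \<Rightarrow> (nat \<Rightarrow> real). (\<forall>j\<in>{1..s}. i j \<in> I) \<longrightarrow>
              ennreal_root n (vol n (\<Inter>j\<in>{1..s}. strip n (v (i j))))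
                \<ge> ennreal (c \<delta> * (sqrt (real n) / ln (1 + real n))) \<and>
              (\<forall>\<beta>::real. \<beta> > 0 \<longrightarrow>
                (\<Inter>j\<in>{1..s}. strip n (v (i j)))
                  \<subseteq> scale_Rn n \<beta> (\<Inter>k\<in>I. strip n (v k)) \<longrightarrow>
                \<beta> \<ge> c \<delta> * (sqrt (real n) / ln (1 + real n))))))))"
proof (intro exI[of _ "\<lambda>\<delta>. 1 / (5 * (4 + 2 * \<delta>))"] conjI allI impI)
  fix n :: nat assume n: "n \<ge> 1"
  obtain r where r: "r \<ge> sqrt n / 5" and vol_r: "vol n (ball_Rn n r) = 1"
    using unit_volume_ball[OF n] .
  have "sqrt n > 0"
    using n by simp
  with r have "r > 0" by linarith
  \<comment> \<open>All vectors whose strip contains the ball of radius \<open>r\<close>. The set is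
    fixed before \<open>\<delta>\<close> appears, so the family depends on \<open>n\<close>
    only.\<close>
  define I where "I = {v \<in> Rn n. r\<^sup>2 * inner_Rn n v v \<le> 1}"
  have ball: "(\<Inter>v\<in>I. strip n v) = ball_Rn n r"
    using ball_Rn_eq_INT_strip[OF \<open>r > 0\<close>] by (simp add: I_def)
  have main: "ennreal_root n (vol n (\<Inter>j\<in>{1..s}. strip n (i j)))
        \<ge> ennreal (1 / (5 * (4 + 2 * \<delta>)) * (sqrt (real n) / ln (1 + real n)))
      \<and> (\<forall>\<beta>>0. (\<Inter>j\<in>{1..s}. strip n (i j)) \<subseteq> scale_Rn n \<beta> (\<Inter>k\<in>I. strip n k) \<longrightarrow>
          \<beta> \<ge> 1 / (5 * (4 + 2 * \<delta>)) * (sqrt (real n) / ln (1 + real n)))"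
    if \<delta>: "\<delta> \<ge> 1" and s: "real s = real n powr \<delta>" and i: "\<forall>j\<in>{1..s}. i j \<in> I" for \<delta> s i
  proof -
    define A where "A = (\<Inter>j\<in>{1..s}. strip n (i j))"
    \<comment> \<open>Chosen so that \<open>exp (t\<^sup>2 / 2)\<close> equals \<open>4 * s\<close>
      exactly, the equality case of the union bound.\<close>
    define t where "t = sqrt (2 * ln (4 * real s))"
    have "real s \<ge> 1"
      using n \<delta> by (simp add: s ge_one_powr_ge_zero)
    then have "t > 0" and t2: "t\<^sup>2 = 2 * ln (4 * real s)"
      by (auto simp: t_def)
    then have "exp (t\<^sup>2 / 2) = 4 * real s"
      using \<open>real s \<ge> 1\<close> by simp
    then have volA: "vol n A \<ge> ennreal ((r / t) ^ n)"
      unfolding A_def using \<open>real s \<ge> 1\<close> n \<open>r > 0\<close> \<open>t > 0\<close> i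
      by (intro vol_INT_strip_ge) (auto simp: I_def)
    \<comment> \<open>The constant combines the 5 from the radius bound with the factor
      \<open>4 + 2 * \<delta>\<close> from the bound on \<open>t\<close>.\<close>
    have "1 / (5 * (4 + 2 * \<delta>)) * (sqrt n / ln (1 + real n)) = (sqrt n / 5) / ((4 + 2 * \<delta>) * ln (1 + real n))"
      by simp
    also have "\<dots> \<le> r / t"
      using r \<open>t > 0\<close> \<open>r > 0\<close> sqrt_ln_le[OF n \<delta>] by (intro frac_le) (auto simp: t_def s)
    finally have bound: "1 / (5 * (4 + 2 * \<delta>)) * (sqrt n / ln (1 + real n)) \<le> r / t" .
    have "ennreal_root n (vol n A) \<ge> ennreal (r / t)"
      using ennreal_root_ge[OF n _ volA] \<open>r > 0\<close> \<open>t > 0\<close> by simp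
    then have "ennreal_root n (vol n A) \<ge> ennreal (1 / (5 * (4 + 2 * \<delta>)) * (sqrt n / ln (1 + real n)))"
      using bound ennreal_leI order_trans by blast
    \<comment> \<open>The inclusion is used only through volumes: the ball has volume 1, so its
      dilate has volume \<open>\<beta> ^ n\<close>, which must be at least
      \<open>(r / t) ^ n\<close>.\<close>
    moreover have "\<beta> \<ge> 1 / (5 * (4 + 2 * \<delta>)) * (sqrt n / ln (1 + real n))"
      if "\<beta> > 0" "A \<subseteq> scale_Rn n \<beta> (\<Inter>k\<in>I. strip n k)" for \<beta>
    proof -
      have "vol n A \<le> vol n (scale_Rn n \<beta> (ball_Rn n r))"
        using that unfolding ball vol_def
        by (intro emeasure_mono sets_scale_Rn sets_ball_Rn) auto
      also have "\<dots> = ennreal (\<beta> ^ n)"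
        using that by (simp add: vol_scale_Rn sets_ball_Rn vol_r ennreal_power)
      finally have "(r / t) ^ n \<le> \<beta> ^ n"
        using volA that(1) by (meson ennreal_le_iff order_trans less_imp_le zero_le_power)
      then have "r / t \<le> \<beta>"
        using n that(1) \<open>r > 0\<close> \<open>t > 0\<close> by (subst (asm) power_mono_iff) auto
      then show ?thesis using bound by linarith
    qed
    ultimately show ?thesis
      unfolding A_def by blast
  qed
  show "\<exists>I v. (\<forall>i\<in>I. v i \<in> Rn n) \<and>
        vol n (\<Inter>i\<in>I. strip n (v i)) = 1 \<and>
        (\<forall>\<delta>::real. \<delta> \<ge> 1 \<longrightarrow>
          (\<forall>s::nat. real s = real n powr \<delta> \<longrightarrow>
            (\<forall>i :: nat \<Rightarrow> (nat \<Rightarrow> real). (\<forall>j\<in>{1..s}. i j \<in> I) \<longrightarrow>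
              ennreal_root n (vol n (\<Inter>j\<in>{1..s}. strip n (v (i j))))
                \<ge> ennreal (1 / (5 * (4 + 2 * \<delta>)) * (sqrt (real n) / ln (1 + real n))) \<and>
              (\<forall>\<beta>::real. \<beta> > 0 \<longrightarrow>
                (\<Inter>j\<in>{1..s}. strip n (v (i j)))
                  \<subseteq> scale_Rn n \<beta> (\<Inter>k\<in>I. strip n (v k)) \<longrightarrow>
                \<beta> \<ge> 1 / (5 * (4 + 2 * \<delta>)) * (sqrt (real n) / ln (1 + real n))))))"
  \<comment> \<open>The strips are indexed by their own vectors, so the map from indices to vectors
    is the identity.\<close>
  proof (intro exI[of _ I] exI[of _ "\<lambda>x. x"] conjI ballI)
    show "x \<in> Rn n" if "x \<in> I" for x
      using that by (simp add: I_def)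
    show "vol n (\<Inter>i\<in>I. strip n i) = 1"
      unfolding ball by (rule vol_r)
  qed (use main in blast)
qed simp

end
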